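(* The minimum number of monochromatic triangles in a line $2$-coloring of the Fano configuration, taken over all line $2$-colorings, is $4$.
   Context: A configuration is a pair $(\mathcal{P},\mathcal{L})$ with $\mathcal{P}$ a finite set of points and $\mathcal{L}$ a finite set of subsets of $\mathcal{P}$ called lines, such that any two distinct points lie together on at most one line, all points are on the same number of lines, all lines contain the same number of points, and there are at least three points. Three points $p_1,p_2,p_3$ form a triangle if there are lines $l_1,l_2,l_3$ with $p_1,p_2\in l_1$, $p_3\notin l_1$; $p_2,p_3\in l_2$, $p_1\notin l_2$; $p_1,p_3\in l_3$, $p_2\notin l_3$. The lines $l_1,l_2,l_3$ are then uniquely determined by the points. Triangles are counted as unordered triples of points, and need not be disjoint from each other. A line $2$-coloring assigns to each line one of the colors red, blue. A triangle is monochromatic if its lines $l_1,l_2,l_3$ all have the same color. The Fano configuration is the projective plane of order $2$: points $\mathbb{Z}/7$, lines $\{i,i+1,i+3\}$ for $i\in\mathbb{Z}/7$. *)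

theory Defs
  imports Main "HOL-Library.FuncSet" "HOL-Library.Numeral_Type"
begin

definition configuration :: "'a set \<Rightarrow> 'a set set \<Rightarrow> bool" where
  "configuration P L \<longleftrightarrow>
     finite P \<and> finite L \<and> (\<forall>l\<in>L. l \<subseteq> P) \<and>
     (\<forall>p\<in>P. \<forall>q\<in>P. \<forall>l\<in>L. \<forall>m\<in>L. p \<noteq> q \<and> {p, q} \<subseteq> l \<and> {p, q} \<subseteq> m \<longrightarrow> l = m) \<and>
     (\<exists>r. \<forall>p\<in>P. card {l\<in>L. p \<in> l} = r) \<and>
     (\<exists>k. \<forall>l\<in>L. card l = k) \<and>
     3 \<le> card P"

definition triangle_on ::
  "'a set \<Rightarrow> 'a set set \<Rightarrow> 'a \<Rightarrow> 'a \<Rightarrow> 'a \<Rightarrow> 'a set \<Rightarrow> 'a set \<Rightarrow> 'a set \<Rightarrow> bool" where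
  "triangle_on P L p1 p2 p3 l1 l2 l3 \<longleftrightarrow>
     p1 \<in> P \<and> p2 \<in> P \<and> p3 \<in> P \<and> l1 \<in> L \<and> l2 \<in> L \<and> l3 \<in> L \<and>
     p1 \<in> l1 \<and> p2 \<in> l1 \<and> p3 \<notin> l1 \<and>
     p2 \<in> l2 \<and> p3 \<in> l2 \<and> p1 \<notin> l2 \<and>
     p1 \<in> l3 \<and> p3 \<in> l3 \<and> p2 \<notin> l3"

datatype color = Red | Blue

text \<open>Colorings are taken extensional, so that each coloring of the lines is represented by exactly
  one function.\<close>

definition line_colorings :: "'a set set \<Rightarrow> ('a set \<Rightarrow> color) set" where
  "line_colorings L = L \<rightarrow>\<^sub>E UNIV"

text \<open>A triangle is counted as its (unordered) set of vertices. In a configuration its lines are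
  determined by the vertices (see \<open>triangle_on_lines_unique\<close>), so nothing depends on the choice of
  the existentially quantified lines.\<close>

definition mono_triangles :: "'a set \<Rightarrow> 'a set set \<Rightarrow> ('a set \<Rightarrow> color) \<Rightarrow> 'a set set" where
  "mono_triangles P L c =
     {{p1, p2, p3} | p1 p2 p3.
        \<exists>l1 l2 l3. triangle_on P L p1 p2 p3 l1 l2 l3 \<and> c l1 = c l2 \<and> c l2 = c l3}"

text \<open>The numeral type \<open>7\<close> is the ring of integers modulo \<open>7\<close>; its addition is modular.\<close>

definition fano_points :: "7 set" where
  "fano_points = UNIV"

definition fano_lines :: "7 set set" where
  "fano_lines = {{i, i + 1, i + 3} | i. i \<in> UNIV}"

lemma triangle_on_lines_unique:
  assumes "configuration P L"
    and "triangle_on P L p1 p2 p3 l1 l2 l3" and "triangle_on P L p1 p2 p3 m1 m2 m3"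
  shows "l1 = m1 \<and> l2 = m2 \<and> l3 = m3"
proof -
  have u: "l = m" if "p \<in> P" "q \<in> P" "l \<in> L" "m \<in> L" "p \<noteq> q" "p \<in> l" "q \<in> l" "p \<in> m" "q \<in> m"
    for p q l m
    using assms(1) that unfolding configuration_def by blast
  from assms(2,3) show ?thesis
    unfolding triangle_on_def using u[of p1 p2 l1 m1] u[of p2 p3 l2 m2] u[of p1 p3 l3 m3] by blast
qed

lemma UNIV_7: "(UNIV :: 7 set) = {0, 1, 2, 3, 4, 5, 6}"
  by (rule sym, rule card_subset_eq) simp_all

lemma fano_lines_eq:
  "fano_lines = {{0,1,3}, {1,2,4}, {2,3,5}, {3,4,6}, {4,5,0}, {5,6,1}, {6,0,2}}"
proof -
  have "fano_lines = (\<lambda>i. {i, i + 1, i + 3}) ` UNIV"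
    unfolding fano_lines_def by blast
  moreover have "(7 :: 7) = 0" "(8 :: 7) = 1" "(9 :: 7) = 2"
    by simp_all
  ultimately show ?thesis
    unfolding UNIV_7 by simp
qed

lemma configuration_fano: "configuration fano_points fano_lines"
proof -
  have filter_insert: "{l \<in> insert a A. p \<in> l} = (if p \<in> a then insert a {l\<in>A. p \<in> l} else {l\<in>A. p \<in> l})"
    for a p and A :: "7 set set"
    by auto
  have r: "card {l\<in>fano_lines. p \<in> l} = 3" for p
  proof -
    have "p \<in> {0, 1, 2, 3, 4, 5, 6}"
      using UNIV_7 by blast
    then show ?thesis
      unfolding fano_lines_eq filter_insert
      by (elim insertE emptyE; simp add: set_eq_subset)
  qed
  have "\<forall>l\<in>fano_lines. \<forall>m\<in>fano_lines. l = m \<or> card (l \<inter> m) = 1"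
    unfolding fano_lines_eq by simp
  then have u: "\<forall>p\<in>fano_points. \<forall>q\<in>fano_points. \<forall>l\<in>fano_lines. \<forall>m\<in>fano_lines.
      p \<noteq> q \<and> {p, q} \<subseteq> l \<and> {p, q} \<subseteq> m \<longrightarrow> l = m"
    by (metis One_nat_def card_1_singletonE insert_subset le_inf_iff singletonD)
  have k: "\<forall>l\<in>fano_lines. card l = 3"
    unfolding fano_lines_eq by simp
  have "finite fano_lines"
    unfolding fano_lines_eq by simp
  then show ?thesis
    unfolding configuration_def using r u k by (auto simp: fano_points_def simp del: insert_subset)
qed

end

theory Submission
  imports Defs
begin

text \<open>Give the line \<open>t\<close> the sign \<open>e t\<close>, which is \<open>1\<close> or \<open>- 1\<close> according to its color. A triangle with sides
  \<open>i, j, k\<close> is monochromatic or not according to whether \<open>(1 + e i e j + e j e k + e i e k) / 4\<close> is \<open>1\<close> or \<open>0\<close>.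
  There are 28 triangles and each pair of lines occurs as sides of four of them, so summing over all
  triangles gives \<open>7 + \<Sigma> e i e j = 7 + (\<sigma>\<^sup>2 - 7) / 2\<close>, with the first sum over pairs of lines and
  \<open>\<sigma>\<close> the sum of all seven signs. As \<open>\<sigma>\<close> is odd,
  this is at least \<open>4\<close>, with equality iff \<open>\<sigma> = 1\<close> or \<open>\<sigma> = - 1\<close>.\<close>

lemma all_7: "(\<forall>x::7. P x) \<longleftrightarrow> P 0 \<and> P 1 \<and> P 2 \<and> P 3 \<and> P 4 \<and> P 5 \<and> P 6"
  using UNIV_7 by (metis (full_types) UNIV_I empty_iff insert_iff)

lemma three_times_five: "3 * (5 * t) = (t::7)"
proof -
  have "\<forall>t::7. 3 * (5 * t) = t"
    by (simp add: all_7)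
  then show ?thesis ..
qed

text \<open>Compared with \<open>fano_lines\<close> the index is shifted by one, so that the centroid of \<open>line i\<close> (see below)
  is \<open>i\<close>.\<close>

definition line :: "7 \<Rightarrow> 7 set" where
  "line i = {i + 1, i + 2, i + 4}"

lemma fano_lines_eq_range: "fano_lines = range line"
proof -
  have "{i, i + 1, i + 3} = line (i - 1)" and "line i = {i + 1, (i + 1) + 1, (i + 1) + 3}" for i
    by (simp_all add: line_def algebra_simps)
  then show ?thesis
    unfolding fano_lines_def by (auto; blast)
qed

lemma add_mem_line_add: "t + p \<in> line (t + i) \<longleftrightarrow> p \<in> line i"
  by (simp add: line_def algebra_simps)

text \<open>As \<open>{1, 2, 4}\<close> is a perfect difference set modulo 7, \<open>q - p\<close>
  tells which of \<open>i + 1\<close>, \<open>i + 2\<close>, \<open>i + 4\<close> the point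
  \<open>p\<close> is on its line with \<open>q\<close>; 6, 5, 3 are -1, -2, -4. For
  \<open>p = q\<close> the value is arbitrary.\<close>

definition join :: "7 \<Rightarrow> 7 \<Rightarrow> 7" where
  "join p q = p + (if q - p \<in> {1, 3} then 6 else if q - p \<in> {2, 6} then 5 else 3)"

lemma join_add: "join (t + p) (t + q) = t + join p q"
  by (simp add: join_def)

text \<open>Translation by \<open>- p\<close> reduces this to \<open>p = 0\<close>, a finite
  check.\<close>

lemma join_unique:
  assumes "p \<noteq> q" "p \<in> line i" "q \<in> line i"
  shows "i = join p q"
proof -
  have "\<forall>x. x \<noteq> 0 \<longrightarrow> (\<forall>i. 0 \<in> line i \<and> x \<in> line i \<longrightarrow> i = join 0 x)"
    by (simp add: all_7 line_def join_def)
  moreover have "0 \<in> line (i - p)" "q - p \<in> line (i - p)"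
    using assms add_mem_line_add[of p 0 "i - p"] add_mem_line_add[of p "q - p" "i - p"] by simp_all
  ultimately have "i - p = join 0 (q - p)"
    using assms(1) by simp
  then show ?thesis
    using join_add[of p 0 "q - p"] by (simp add: algebra_simps)
qed

text \<open>Since \<open>3\<close> is invertible modulo \<open>7\<close>, each triple \<open>{p, q, r}\<close> has a unique centroid \<open>t\<close> with
  \<open>3 t = p + q + r\<close>. The triangles with centroid \<open>0\<close> are \<open>{0, a, - a}\<close> for \<open>a = 1, 2, 4\<close> and \<open>{- 1, - 2, - 4}\<close>;
  they are listed here together with the indices of the sides through the first and second, second
  and third, first and third vertex.\<close>

definition shapes :: "((7 \<times> 7 \<times> 7) \<times> (7 \<times> 7 \<times> 7)) set" where
  "shapes = {((0,1,6),(6,4,5)), ((0,2,5),(5,1,3)), ((0,4,3),(3,2,6)), ((6,5,3),(4,1,2))}"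

lemma shapes_triangle_on:
  "((x, y, z), (i, j, k)) \<in> shapes \<Longrightarrow>
    triangle_on fano_points fano_lines (t + x) (t + y) (t + z) (line (t + i)) (line (t + j)) (line (t + k))"
  unfolding triangle_on_def add_mem_line_add fano_points_def fano_lines_eq_range
  by (simp add: shapes_def) (elim disjE conjE; simp add: line_def)

text \<open>Centroid 0 forces the third vertex to be \<open>- x - y\<close>, so only pairs need
  checking.\<close>

lemma centred_triangle_shape:
  "\<forall>x y. x \<noteq> y \<longrightarrow> y \<noteq> - x - y \<longrightarrow> x \<noteq> - x - y \<longrightarrow> - x - y \<notin> line (join x y) \<longrightarrow>
    (\<exists>((u,v,w),(i,j,k))\<in>shapes. {x, y, - x - y} = {u, v, w} \<and>
      {join x y, join y (- x - y), join x (- x - y)} = {i, j, k})"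
  by (simp add: all_7 shapes_def line_def join_def set_eq_subset)

lemma triangle_shape:
  assumes "triangle_on fano_points fano_lines p q r (line a) (line b) (line c)"
  obtains t x y z i j k where "((x, y, z), (i, j, k)) \<in> shapes"
    "{p, q, r} = {t + x, t + y, t + z}" "{a, b, c} = {t + i, t + j, t + k}"
proof -
  \<comment> \<open>The centroid, as 5 inverts 3 modulo 7.\<close>
  define t where "t = 5 * (p + q + r)"
  define x y where "x = p - t" and "y = q - t"
  have pq: "p = t + x" "q = t + y"
    by (simp_all add: x_def y_def)
  have "3 * t = p + q + r"
    using three_times_five by (simp add: t_def)
  then have r: "r = t + (- x - y)"
    by (simp add: x_def y_def algebra_simps)
  have d: "p \<noteq> q" "q \<noteq> r" "p \<noteq> r" "r \<notin> line a"
    and abc: "a = join p q" "b = join q r" "c = join p r"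
    using assms by (auto simp: triangle_on_def intro!: join_unique)
  have "x \<noteq> y" "y \<noteq> - x - y" "x \<noteq> - x - y"
    using d(1-3) unfolding pq r by simp_all
  moreover have "- x - y \<notin> line (join x y)"
    using d(4) unfolding abc pq r join_add add_mem_line_add .
  ultimately have "\<exists>((u,v,w),(i,j,k))\<in>shapes. {x, y, - x - y} = {u, v, w} \<and>
      {join x y, join y (- x - y), join x (- x - y)} = {i, j, k}"
    using centred_triangle_shape by blast
  then obtain u v w i j k where s: "((u,v,w),(i,j,k)) \<in> shapes"
    and V: "{x, y, - x - y} = {u, v, w}"
    and S: "{join x y, join y (- x - y), join x (- x - y)} = {i, j, k}"
    by (elim bexE case_prodE conjE) (auto simp: that)
  have "{p, q, r} = (+) t ` {x, y, - x - y}" "{a, b, c} = (+) t ` {join x y, join y (- x - y), join x (- x - y)}"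
    unfolding abc pq r join_add by simp_all
  then show ?thesis
    using that[OF s, of t] unfolding V S by simp
qed

fun vertices :: "7 \<times> (7 \<times> 7 \<times> 7) \<times> (7 \<times> 7 \<times> 7) \<Rightarrow> 7 set" where
  "vertices (t, (x, y, z), _) = {t + x, t + y, t + z}"

fun monochromatic :: "(7 set \<Rightarrow> color) \<Rightarrow> 7 \<times> (7 \<times> 7 \<times> 7) \<times> (7 \<times> 7 \<times> 7) \<Rightarrow> bool" where
  "monochromatic c (t, _, (i, j, k)) \<longleftrightarrow> c (line (t + i)) = c (line (t + j)) \<and> c (line (t + j)) = c (line (t + k))"

lemma mono_triangles_fano:
  "mono_triangles fano_points fano_lines c = vertices ` {s \<in> UNIV \<times> shapes. monochromatic c s}"
  (is "?M = ?V")
proof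
  show "?M \<subseteq> ?V"
  proof
    fix T assume "T \<in> ?M"
    then obtain p q r l1 l2 l3 where T: "T = {p, q, r}"
      and tri: "triangle_on fano_points fano_lines p q r l1 l2 l3" and eq: "c l1 = c l2" "c l2 = c l3"
      unfolding mono_triangles_def by blast
    then obtain a b d where l: "l1 = line a" "l2 = line b" "l3 = line d"
      by (auto simp: triangle_on_def fano_lines_eq_range)
    obtain t x y z i j k where s: "((x, y, z), (i, j, k)) \<in> shapes"
      and V: "{p, q, r} = {t + x, t + y, t + z}" and S: "{a, b, d} = {t + i, t + j, t + k}"
      using tri unfolding l by (rule triangle_shape)
    \<comment> \<open>Stated for the set of sides, because \<open>triangle_shape\<close> forgets
      their order.\<close>
    have "\<forall>i\<in>{a, b, d}. c (line i) = c (line a)"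
      using eq by (simp add: l)
    then have "monochromatic c (t, (x, y, z), (i, j, k))"
      unfolding S by simp
    then show "T \<in> ?V"
      using s V unfolding T by force
  qed
  show "?V \<subseteq> ?M"
    unfolding mono_triangles_def using shapes_triangle_on by fastforce
qed

text \<open>The vertices of a shape sum to 0, so the vertex sum of a translate is
  \<open>3 * t\<close> and recovers \<open>t\<close>.\<close>

lemma inj_on_vertices: "inj_on vertices (UNIV \<times> shapes)"
proof (rule inj_onI)
  fix s s' assume "s \<in> UNIV \<times> shapes" "s' \<in> UNIV \<times> shapes" and eq: "vertices s = vertices s'"
  then obtain t x t' x' where s: "s = (t, x)" "s' = (t', x')" and x: "x \<in> shapes" "x' \<in> shapes"
    by blast
  have V: "vertices (t, x) = (+) t ` vertices (0, x)" for t x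
    by (cases x rule: prod.exhaust; cases "fst x") auto
  have sum: "\<Sum>(vertices (t, x)) = 3 * t" if "x \<in> shapes" for t x
    using that by (auto simp: shapes_def)
  have "3 * t = 3 * t'"
    using sum[OF x(1)] sum[OF x(2)] eq unfolding s by metis
  then have t: "t = t'"
    by (metis mult.left_commute three_times_five)
  then have "vertices (0, x) = vertices (0, x')"
    using eq V[of t x] V[of t x'] unfolding s by (metis inj_image_eq_iff[OF inj_on_add])
  then have "x = x'"
    using x by (auto simp: shapes_def set_eq_subset)
  with s t show "s = s'" by simp
qed

lemma sum_UNIV_add_right: "(\<Sum>t\<in>UNIV. f (t + a)) = (\<Sum>t\<in>UNIV. f t)"
  for f :: "7 \<Rightarrow> int"
  by (rule sum.reindex_bij_witness[of _ "\<lambda>t. t - a" "\<lambda>t. t + a"]) simp_all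

lemma card_mono_triangles_fano:
  fixes c :: "7 set \<Rightarrow> color"
  defines "e \<equiv> \<lambda>t. if c (line t) = Red then 1 else - 1 :: int"
  shows "2 * int (card (mono_triangles fano_points fano_lines c)) = 7 + (\<Sum>t\<in>UNIV. e t)\<^sup>2"
proof -
  \<comment> \<open>the autocorrelation of \<open>e\<close>\<close>
  define R where "R d = (\<Sum>t\<in>UNIV. e t * e (t + d))" for d
  have R: "(\<Sum>t\<in>UNIV. e (t + i) * e (t + j)) = R (j - i)" for i j
    using sum_UNIV_add_right[of "\<lambda>t. e t * e (t + (j - i))" i] by (simp add: R_def algebra_simps)
  have R_minus: "R (- d) = R d" for d
    using R[of d 0] by (simp add: R_def mult.commute)
  have "e t * e t = 1" for t
    by (simp add: e_def)
  then have R_0: "R 0 = 7"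
    by (simp add: R_def)
  have "(4 :: 7) = - 3" "(5 :: 7) = - 2" "(6 :: 7) = - 1"
    by simp_all
  then have R_eqs: "R 4 = R 3" "R 5 = R 2" "R 6 = R 1"
    by (metis R_minus)+
  have "(\<Sum>t\<in>UNIV. e t)\<^sup>2 = (\<Sum>t\<in>UNIV. e t * (\<Sum>d\<in>UNIV. e (d + t)))"
    unfolding sum_UNIV_add_right by (simp only: power2_eq_square sum_distrib_right)
  also have "\<dots> = (\<Sum>t\<in>UNIV. \<Sum>d\<in>UNIV. e t * e (t + d))"
    by (simp only: sum_distrib_left add.commute)
  also have "\<dots> = (\<Sum>d\<in>UNIV. R d)"
    unfolding R_def[abs_def] by (rule sum.swap)
  also have "\<dots> = 7 + 2 * (R 1 + R 2 + R 3)"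
    unfolding UNIV_7 by (simp add: R_0 R_eqs)
  finally have square: "(\<Sum>t\<in>UNIV. e t)\<^sup>2 = 7 + 2 * (R 1 + R 2 + R 3)" .

  have ind: "4 * of_bool (monochromatic c (t, s)) = (case s of (_, i, j, k) \<Rightarrow>
      1 + e (t + i) * e (t + j) + e (t + j) * e (t + k) + e (t + i) * e (t + k))" for t s
  proof -
    obtain v i j k where "s = (v, i, j, k)"
      by (metis prod.exhaust)
    then show ?thesis
      by (cases "c (line (t + i))"; cases "c (line (t + j))"; cases "c (line (t + k))") (simp_all add: e_def)
  qed
  have fin: "finite ((UNIV :: 7 set) \<times> shapes)"
    by (intro finite_cartesian_product) (simp_all add: shapes_def)
  have "card (mono_triangles fano_points fano_lines c) = card {s \<in> UNIV \<times> shapes. monochromatic c s}"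
    unfolding mono_triangles_fano by (rule card_image) (rule inj_on_subset[OF inj_on_vertices], blast)
  then have "4 * int (card (mono_triangles fano_points fano_lines c))
      = (\<Sum>s\<in>UNIV \<times> shapes. 4 * of_bool (monochromatic c s))"
    using fin by (simp add: sum_distrib_left[symmetric] Int_def)
  also have "\<dots> = (\<Sum>t\<in>UNIV. \<Sum>s\<in>shapes. 4 * of_bool (monochromatic c (t, s)))"
    unfolding sum.cartesian_product by (rule sum.cong) auto
  \<comment> \<open>Among the twelve pairs of sides in \<open>shapes\<close>, each of the
    differences 1, 2, 3 occurs four times up to sign.\<close>
  also have "\<dots> = 28 + 4 * (R 1 + R 2 + R 3)"
    unfolding ind by (simp add: shapes_def sum.distrib R R_minus R_eqs)
  finally show ?thesis
    using square by simp
qed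

theorem theorem4p1:
  shows "Min ((\<lambda>c. card (mono_triangles fano_points fano_lines c)) ` line_colorings fano_lines) = 4"
proof (rule Min_eqI)
  have "(UNIV :: color set) = {Red, Blue}"
    using color.exhaust by blast
  then have "finite (UNIV :: color set)"
    by (metis finite.simps)
  then show "finite ((\<lambda>c. card (mono_triangles fano_points fano_lines c)) ` line_colorings fano_lines)"
    unfolding line_colorings_def by (intro finite_imageI finite_PiE) (simp_all add: fano_lines_eq)
next
  fix n assume "n \<in> (\<lambda>c. card (mono_triangles fano_points fano_lines c)) ` line_colorings fano_lines"
  then obtain c where n: "n = card (mono_triangles fano_points fano_lines c)"
    by blast
  define \<sigma> :: int where "\<sigma> = (\<Sum>t\<in>UNIV. if c (line t) = Red then 1 else - 1)"
  have "odd \<sigma>"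
    unfolding \<sigma>_def UNIV_7 by simp
  then have "\<sigma> \<noteq> 0"
    by auto
  then have "1 \<le> \<sigma>\<^sup>2"
    by (simp add: int_one_le_iff_zero_less)
  then show "4 \<le> n"
    using card_mono_triangles_fano[of c] unfolding n \<sigma>_def by linarith
next
  \<comment> \<open>Three lines pass through 0 and four do not, so the signs sum to -1.\<close>
  define c where "c = (\<lambda>l\<in>fano_lines. if 0 \<in> l then Red else Blue)"
  have "c (line t) = (if 0 \<in> line t then Red else Blue)" for t
    by (simp add: c_def fano_lines_eq_range)
  then have "2 * int (card (mono_triangles fano_points fano_lines c)) = 8"
    unfolding card_mono_triangles_fano UNIV_7 by (simp add: line_def)
  then have "4 = card (mono_triangles fano_points fano_lines c)"
    by simp
  moreover have "c \<in> line_colorings fano_lines"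
    by (simp add: c_def line_colorings_def)
  ultimately show "4 \<in> (\<lambda>c. card (mono_triangles fano_points fano_lines c)) ` line_colorings fano_lines"
    by blast
qed

end
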